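(* Let $0<\beta<\kappa$ and let $f\in\Pi(M,M^n)$ be continuous. Assume that $\mathbb E_{Q_n}[(B^n_T)^{-1}]$ converges to $\mathbb E_Q[B_T^{-1}]$ with rate $o(n^{-\beta})$, and that the digital option prices satisfy $$V^D_{n,Q_n}(a)=V^D_Q(a)+\frac{A_n(a)}{n^\beta}+O(n^{-\kappa}),$$ where $A_n(a)$ is bounded in $n$. Put $$F_{\delta,\theta}(a)=\int_0^a|y^\delta f'(y)|^{1+\theta}\,\mathrm dy .$$ If there exist constants $\delta$ and $\theta$ such that $$\theta>\frac{\beta}{\kappa-\beta},\qquad \delta>\frac{\theta}{1+\theta},$$ $$V_Q^{F_{\delta,\theta}}<\infty,$$ $$\sup_n\int_0^\infty|a^\delta f'(a)|^{1+\theta}|A_n(a)|\,\mathrm da<\infty,$$ and $X^n_T$ is $(B^n,F_{\delta,\theta})$-UI, then $$V^f_{n,Q_n}=V^f_Q+\frac1{n^\beta}\int_0^\infty f'(a)A_n(a)\,\mathrm da+o(n^{-\beta}).$$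
   Context: Fix a maturity $T>0$ and write $\mathbb{R}_+=[0,\infty)$. Markets. A market is a six-tuple $(\Omega,\mathcal F,B,S,(\mathcal F_t),\mathbb P)$, where $B$ is the bond process, which is increasing, adapted and satisfies $B_0=1$, and $(\mathcal F_t)$ is the filtration generated by the stock process $S$. An underlying asset $X$ is a process $X_t$ adapted to $(\mathcal F_t)$, with $X_T$ taking values in $\mathbb{R}_+$. The set of equivalent martingale measures is assumed nonempty and one such measure $Q$ is fixed (the model need not be complete). Prices are $V_Q^f=\mathbb E_Q[B_T^{-1}f(X_T)]$, $V_Q^D(a)=\mathbb E_Q[B_T^{-1}\mathbf 1_{X_T>a}]$ and $V_Q^C(a)=\mathbb E_Q[B_T^{-1}(X_T-a)^+]$. The original model $(M)$ is such a market with chosen $Q$ and underlying $X_T$. The approximating models $(M^n)$ are markets $(\Omega^n,\mathcal F^n,B^n,S^n,(\mathcal F^n_t),\mathbb P^n)$ with chosen equivalent martingale measures $Q_n$ and underlying assets $X_T^n$ (also with values in $\mathbb R_+$). Prices in $(M^n)$ are denoted $V^f_{n,Q_n}=\mathbb E_{Q_n}[(B^n_T)^{-1}f(X^n_T)]$ and $V^D_{n,Q_n}(a)=\mathbb E_{Q_n}[(B^n_T)^{-1}\mathbf 1_{X^n_T>a}]$. Payoff classes. $f:\mathbb R_+\to\mathbb R$ belongs to $\Pi$ if $f$ is continuously differentiable except on a finite set of points $0<s_1<\dots<s_N$ (and possibly at $s_0=0$), at which $f$ and $f'$ have jump discontinuities. By convention the jump and left limits at zero are $\Delta_-f(0)=f(0-)=f'(0-)=0$.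 Further, $f\in\Pi_Q(X_T)$ if $f\in\Pi$, $f(X_T)\in L^1(Q)$, $\lim_{x\to\infty}|f(x-)|\,Q(X_T\ge x)=0$, and the Riemann–Stieltjes integral $\int_0^\infty f'(a)\,V_Q^C(\mathrm da)$ exists. The class $\Pi_{Q_n}(X^n_T)$ is defined in the same way from $(M^n)$. Finally, $f\in\Pi(M,M^n)$ means that $f\in\Pi_Q(X_T)\cap\bigcap_n\Pi_{Q_n}(X_T^n)$ and that $V_Q^D$ and $f$ have no common jump points. Uniform integrability. For a payoff $F\in\bigcap_n\Pi_{Q_n}(X^n_T)$, $X^n_T$ is uniformly integrable with respect to the pair $(B^n,F)$, or $(B^n,F)$-UI, if for every $\epsilon>0$ there is a number $a$ such that $\sup_n\left|\mathbb E_{Q_n}[(B^n_T)^{-1}F(X^n_T)\mathbf 1_{X^n_T>a}]\right|<\epsilon$. "Converges with rate $o(n^{-\beta})$" means $\mathbb E_{Q_n}[(B^n_T)^{-1}]-\mathbb E_Q[B_T^{-1}]=o(n^{-\beta})$. The $O(n^{-\kappa})$ term in the digital expansion is of the form $O_n(a)n^{-\kappa}$ for some function $O_n(a)$ which is bounded in $n$.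
   Formalization: The function O_n(a) in the O(n^{-κ}) term is assumed bounded uniformly in n and in the strike a, not only in n for each fixed a; with a bound for each fixed a only, the claim is false. *)

theory Defs
  imports "HOL-Probability.Probability"
begin

section \<open>Markets\<close>

text \<open>
  The measure \<open>physical\<close> carries the underlying space, the sigma-algebra and the physical
  probability.  The filtration is not a field since it is determined by the stock, see
  \<open>stock_filtration\<close>.  Processes are functions of time and state, and only times in
  \<open>[0, T]\<close> matter, where \<open>T\<close> is the maturity.
\<close>

record 'a market =
  physical :: "'a measure"
  bond :: "real \<Rightarrow> 'a \<Rightarrow> real"
  stock :: "real \<Rightarrow> 'a \<Rightarrow> real"

definition stock_filtration :: "'a market \<Rightarrow> real \<Rightarrow> 'a measure" where
  "stock_filtration M t =
     sigma (space (physical M))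
       (\<Union>s\<in>{0..t}. {stock M s -` A \<inter> space (physical M) |A. A \<in> sets borel})"

definition market :: "real \<Rightarrow> 'a market \<Rightarrow> bool" where
  "market T M \<longleftrightarrow>
     prob_space (physical M) \<and>
     (\<forall>t\<in>{0..T}. stock M t \<in> borel_measurable (physical M)) \<and>
     (\<forall>t\<in>{0..T}. bond M t \<in> borel_measurable (stock_filtration M t)) \<and>
     (\<forall>\<omega>\<in>space (physical M). bond M 0 \<omega> = 1 \<and> mono_on {0..T} (\<lambda>t. bond M t \<omega>))"

definition martingale_on ::
  "real \<Rightarrow> 'a measure \<Rightarrow> (real \<Rightarrow> 'a measure) \<Rightarrow> (real \<Rightarrow> 'a \<Rightarrow> real) \<Rightarrow> bool" where
  "martingale_on T Q F Y \<longleftrightarrow>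
     (\<forall>t\<in>{0..T}. Y t \<in> borel_measurable (F t) \<and> integrable Q (Y t)) \<and>
     (\<forall>t\<in>{0..T}. \<forall>s\<in>{0..t}. AE \<omega> in Q. real_cond_exp Q (F s) (Y t) \<omega> = Y s \<omega>)"

definition equivalent_martingale_measure :: "real \<Rightarrow> 'a market \<Rightarrow> 'a measure \<Rightarrow> bool" where
  "equivalent_martingale_measure T M Q \<longleftrightarrow>
     prob_space Q \<and> sets Q = sets (physical M) \<and>
     absolutely_continuous (physical M) Q \<and> absolutely_continuous Q (physical M) \<and>
     martingale_on T Q (stock_filtration M) (\<lambda>t \<omega>. inverse (bond M t \<omega>) * stock M t \<omega>)"

definition underlying_asset :: "real \<Rightarrow> 'a market \<Rightarrow> (real \<Rightarrow> 'a \<Rightarrow> real) \<Rightarrow> bool" where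
  "underlying_asset T M X \<longleftrightarrow>
     (\<forall>t\<in>{0..T}. X t \<in> borel_measurable (stock_filtration M t)) \<and>
     (\<forall>\<omega>\<in>space (physical M). 0 \<le> X T \<omega>)"


section \<open>Prices\<close>

definition bond_price :: "real \<Rightarrow> 'a market \<Rightarrow> 'a measure \<Rightarrow> real" where
  "bond_price T M Q = (LINT \<omega>|Q. inverse (bond M T \<omega>))"

definition payoff_price ::
  "real \<Rightarrow> 'a market \<Rightarrow> 'a measure \<Rightarrow> (real \<Rightarrow> 'a \<Rightarrow> real) \<Rightarrow> (real \<Rightarrow> real) \<Rightarrow> real" where
  "payoff_price T M Q X f = (LINT \<omega>|Q. inverse (bond M T \<omega>) * f (X T \<omega>))"

definition digital_price ::
  "real \<Rightarrow> 'a market \<Rightarrow> 'a measure \<Rightarrow> (real \<Rightarrow> 'a \<Rightarrow> real) \<Rightarrow> real \<Rightarrow> real" where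
  "digital_price T M Q X a = payoff_price T M Q X (indicat_real {a<..})"

definition call_price ::
  "real \<Rightarrow> 'a market \<Rightarrow> 'a measure \<Rightarrow> (real \<Rightarrow> 'a \<Rightarrow> real) \<Rightarrow> real \<Rightarrow> real" where
  "call_price T M Q X a = payoff_price T M Q X (\<lambda>x. max (x - a) 0)"


section \<open>Payoff classes\<close>

text \<open>
  A payoff is a function on \<open>[0, \<infinity>)\<close>, represented by a total function whose values at negative
  arguments are irrelevant.  Its derivative is \<open>deriv f\<close>; at \<open>0\<close> and at the finitely many
  exceptional points this takes an unspecified value, which affects none of the integrals below:
  they are taken with respect to Lebesgue measure or to the call price, and the latter is
  Lipschitz in the strike.
\<close>

text \<open>
  The class \<open>\<Pi>\<close>.  The set \<open>S\<close> consists of the positive exceptional points.  Continuous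
  differentiability at \<open>0\<close> entails right limits of the payoff and its derivative there, and
  so does an admissible jump at \<open>0\<close>; so exactly the right limits are required at \<open>0\<close>.
\<close>

definition payoff_class :: "(real \<Rightarrow> real) set" where
  "payoff_class = {f. \<exists>S. finite S \<and> S \<subseteq> {0<..} \<and>
     (\<forall>x\<in>{0<..} - S. f differentiable (at x)) \<and>
     continuous_on ({0<..} - S) (deriv f) \<and>
     (\<forall>s\<in>insert 0 S. (\<exists>l. (f \<longlongrightarrow> l) (at_right s)) \<and> (\<exists>l. (deriv f \<longlongrightarrow> l) (at_right s))) \<and>
     (\<forall>s\<in>S. (\<exists>l. (f \<longlongrightarrow> l) (at_left s)) \<and> (\<exists>l. (deriv f \<longlongrightarrow> l) (at_left s)))}"

text \<open>
  Riemann--Stieltjes integral of \<open>g\<close> against \<open>h\<close>: the limit of Riemann--Stieltjes sums as the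
  mesh tends to zero (a uniform mesh rather than a gauge).
\<close>

definition has_RS_integral ::
  "(real \<Rightarrow> real) \<Rightarrow> (real \<Rightarrow> real) \<Rightarrow> real \<Rightarrow> real \<Rightarrow> real \<Rightarrow> bool" where
  "has_RS_integral g h a b I \<longleftrightarrow>
     (\<forall>\<epsilon>>0. \<exists>d>0. \<forall>p. p tagged_division_of {a..b} \<and> (\<forall>(x, K)\<in>p. Sup K - Inf K < d) \<longrightarrow>
        \<bar>(\<Sum>(x, K)\<in>p. g x * (h (Sup K) - h (Inf K))) - I\<bar> < \<epsilon>)"

definition RS_integral_exists_0_inf :: "(real \<Rightarrow> real) \<Rightarrow> (real \<Rightarrow> real) \<Rightarrow> bool" where
  "RS_integral_exists_0_inf g h \<longleftrightarrow>
     (\<exists>I L. (\<forall>R\<ge>0. has_RS_integral g h 0 R (I R)) \<and> (I \<longlongrightarrow> L) at_top)"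

text \<open>The class \<open>\<Pi>\<^sub>Q(X\<^sub>T)\<close>; the left limit \<open>f(x-)\<close> is \<open>Lim (at_left x) f\<close>.\<close>

definition payoff_class_of ::
  "real \<Rightarrow> 'a market \<Rightarrow> 'a measure \<Rightarrow> (real \<Rightarrow> 'a \<Rightarrow> real) \<Rightarrow> (real \<Rightarrow> real) set" where
  "payoff_class_of T M Q X = {f. f \<in> payoff_class \<and>
     integrable Q (\<lambda>\<omega>. f (X T \<omega>)) \<and>
     ((\<lambda>x. \<bar>Lim (at_left x) f\<bar> * measure Q {\<omega>\<in>space Q. x \<le> X T \<omega>}) \<longlongrightarrow> 0) at_top \<and>
     RS_integral_exists_0_inf (deriv f) (call_price T M Q X)}"

text \<open>
  The class \<open>\<Pi>(M, M\<^sup>n)\<close>.  Approximating models are indexed by \<open>n \<ge> 1\<close>.  Jump points are those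
  of functions on \<open>[0, \<infinity>)\<close>.
\<close>

definition joint_payoff_class ::
  "real \<Rightarrow> 'a market \<Rightarrow> 'a measure \<Rightarrow> (real \<Rightarrow> 'a \<Rightarrow> real) \<Rightarrow>
   (nat \<Rightarrow> 'b market) \<Rightarrow> (nat \<Rightarrow> 'b measure) \<Rightarrow> (nat \<Rightarrow> real \<Rightarrow> 'b \<Rightarrow> real) \<Rightarrow> (real \<Rightarrow> real) set" where
  "joint_payoff_class T M Q X Mn Qn Xn =
     {f \<in> payoff_class_of T M Q X \<inter> (\<Inter>n\<in>{1..}. payoff_class_of T (Mn n) (Qn n) (Xn n)).
        \<forall>a\<ge>0. continuous (at a within {0..}) (digital_price T M Q X) \<or>
               continuous (at a within {0..}) f}"


section \<open>Uniform integrability\<close>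

definition uniformly_integrable_pair ::
  "real \<Rightarrow> (nat \<Rightarrow> 'b market) \<Rightarrow> (nat \<Rightarrow> 'b measure) \<Rightarrow> (nat \<Rightarrow> real \<Rightarrow> 'b \<Rightarrow> real) \<Rightarrow>
   (real \<Rightarrow> real) \<Rightarrow> bool" where
  "uniformly_integrable_pair T Mn Qn Xn F \<longleftrightarrow>
     F \<in> (\<Inter>n\<in>{1..}. payoff_class_of T (Mn n) (Qn n) (Xn n)) \<and>
     (\<forall>\<epsilon>>0. \<exists>a. (SUP n\<in>{1..}.
        ereal \<bar>LINT \<omega>|Qn n. inverse (bond (Mn n) T \<omega>) * F (Xn n T \<omega>) * indicat_real {a<..} (Xn n T \<omega>)\<bar>)
          < ereal \<epsilon>)"

definition dominating_payoff :: "(real \<Rightarrow> real) \<Rightarrow> real \<Rightarrow> real \<Rightarrow> real \<Rightarrow> real" where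
  "dominating_payoff f \<delta> \<theta> a = (LINT y:{0..a}|lborel. \<bar>y powr \<delta> * deriv f y\<bar> powr (1 + \<theta>))"


section \<open>Digital expansion\<close>

text \<open>
  The remainder \<open>O(n\<^sup>-\<^sup>\<kappa>)\<close> has the form \<open>R n a\<close> times \<open>n powr (- \<kappa>)\<close> with \<open>R\<close> bounded uniformly
  in \<open>n\<close> and in the strike.  For a bound in \<open>n\<close> at each fixed strike only, the transfer of
  rates fails: shifting mass across an interval which shrinks slowly to \<open>0\<close> changes each
  digital price for finitely many \<open>n\<close> only.  The coefficient \<open>A\<close> need only be bounded in \<open>n\<close>
  strike by strike.
\<close>

definition digital_expansion ::
  "real \<Rightarrow> 'a market \<Rightarrow> 'a measure \<Rightarrow> (real \<Rightarrow> 'a \<Rightarrow> real) \<Rightarrow>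
   (nat \<Rightarrow> 'b market) \<Rightarrow> (nat \<Rightarrow> 'b measure) \<Rightarrow> (nat \<Rightarrow> real \<Rightarrow> 'b \<Rightarrow> real) \<Rightarrow>
   (nat \<Rightarrow> real \<Rightarrow> real) \<Rightarrow> real \<Rightarrow> real \<Rightarrow> bool" where
  "digital_expansion T M Q X Mn Qn Xn A \<beta> \<kappa> \<longleftrightarrow>
     (\<forall>a\<ge>0. \<exists>C. \<forall>n\<ge>1. \<bar>A n a\<bar> \<le> C) \<and>
     (\<exists>R C. (\<forall>n\<ge>1. \<forall>a\<ge>0. \<bar>R n a\<bar> \<le> C) \<and>
       (\<forall>n\<ge>1. \<forall>a\<ge>0. digital_price T (Mn n) (Qn n) (Xn n) a =
          digital_price T M Q X a + A n a / real n powr \<beta> + R n a * real n powr (- \<kappa>)))"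

end

theory Submission
  imports Defs
begin

text \<open>
  Discounting turns each model into a finite measure of mass at most 1 on \<open>[0, \<infinity>)\<close> with tail
  function \<open>D\<close>, the digital price, and Fubini's theorem gives
  \<open>V\<^sup>f = f 0 * b + \<integral> f' D\<close>, where \<open>b\<close> is the bond price.  So the error in the expansion is
  \<open>f 0 * (b\<^sub>n - b) + \<integral> f' E\<^sub>n\<close> with \<open>E\<^sub>n = D\<^sub>n - D - A\<^sub>n / n\<^sup>\<beta>\<close>.  Here \<open>E\<^sub>n = O(n\<^sup>-\<^sup>\<kappa>)\<close> uniformly in the
  strike, while the integrals of \<open>|y\<^sup>\<delta> f'|\<^sup>1\<^sup>+\<^sup>\<theta> |E\<^sub>n|\<close> stay bounded.  The weighted Young inequality
  \<open>u v \<le> \<epsilon> u\<^sup>1\<^sup>+\<^sup>\<theta> + \<epsilon> powr (- 1 / \<theta>) * v powr ((1 + \<theta>) / \<theta>)\<close> with \<open>u = |y\<^sup>\<delta> f'|\<close> and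
  \<open>v = y powr (- \<delta>)\<close>, whose last power is integrable at infinity since \<open>\<delta> > \<theta> / (1 + \<theta>)\<close>, bounds
  \<open>\<integral> |f'| |E\<^sub>n|\<close> by a multiple of \<open>\<epsilon> + n powr (- \<kappa>) * (1 + \<epsilon> powr (- 1 / \<theta>))\<close>.  For
  \<open>\<epsilon> = n powr (- s)\<close> with \<open>\<beta> < s < \<theta> * (\<kappa> - \<beta>)\<close> this is \<open>o(n\<^sup>-\<^sup>\<beta>)\<close>.
\<close>

section \<open>A Young inequality and the weighted integral bound it yields\<close>

text \<open>Compare \<open>v\<close> with \<open>\<epsilon> * u powr \<theta>\<close>. If
  \<open>v\<close> is the smaller, the first summand alone dominates. Otherwise \<open>u\<close> is
  at most \<open>(v / \<epsilon>) powr (1 / \<theta>)\<close>, and multiplying by \<open>v\<close>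
  gives the second summand. The sharp constants of the conjugate exponents are dispensed with, since
  only the power of \<open>\<epsilon>\<close> matters.\<close>

lemma young_split:
  fixes u v \<epsilon> \<theta> :: real
  assumes "0 \<le> u" "0 \<le> v" "0 < \<epsilon>" "0 < \<theta>"
  shows "u * v \<le> \<epsilon> * u powr (1 + \<theta>) + \<epsilon> powr (- 1 / \<theta>) * v powr ((1 + \<theta>) / \<theta>)"
proof (cases "v \<le> \<epsilon> * u powr \<theta>")
  case True
  have "u * v \<le> u * (\<epsilon> * u powr \<theta>)"
    using True assms(1) by (rule mult_left_mono)
  also have "\<dots> = \<epsilon> * u powr (1 + \<theta>)"
    using assms(1) by (simp add: powr_add)
  finally show ?thesis
    by (simp add: add_increasing2)
next
  case False
  then have v: "0 < v" "u powr \<theta> \<le> v / \<epsilon>"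
    using assms by (auto simp: field_simps not_le intro: le_less_trans[rotated])
  have "u = (u powr \<theta>) powr (1 / \<theta>)"
    using assms by (simp add: powr_powr)
  also have "\<dots> \<le> (v / \<epsilon>) powr (1 / \<theta>)"
    using assms v by (intro powr_mono2) auto
  also have "\<dots> = \<epsilon> powr (- 1 / \<theta>) * v powr (1 / \<theta>)"
    using assms v by (simp add: powr_divide powr_minus field_simps)
  finally have "u * v \<le> \<epsilon> powr (- 1 / \<theta>) * v powr (1 / \<theta>) * v"
    using v by (intro mult_right_mono) auto
  also have "\<dots> = \<epsilon> powr (- 1 / \<theta>) * v powr ((1 + \<theta>) / \<theta>)"
    using assms v by (simp add: add_divide_distrib powr_add)
  finally show ?thesis
    using assms by (simp add: add_increasing)
qed

lemma nn_integral_powr_atLeast_1: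
  fixes q :: real
  assumes "1 < q"
  shows "(\<integral>\<^sup>+y\<in>{1..}. ennreal (y powr (- q)) \<partial>lborel) = ennreal (1 / (q - 1))"
proof -
  have "((\<lambda>y. y powr (- q)) has_integral - (1 powr (- q + 1)) / (- q + 1)) {1..}"
    using assms by (intro has_integral_powr_to_inf) auto
  then have "((\<lambda>y. y powr (- q)) has_integral 1 / (q - 1)) {1..}"
    using assms minus_divide_right[of 1 "1 - q"] by simp
  from nn_integral_has_integral_lebesgue[OF _ this]
  show ?thesis
    by (simp add: mult.commute indicator_mult_ennreal nn_integral_completion)
qed

text \<open>On \<open>{0..1}\<close> the factor \<open>g\<close> is bounded. Beyond 1 the Young
  inequality trades \<open>\<bar>g y\<bar>\<close> for the weighted power plus an integrable power
  of \<open>y\<close>, and \<open>e\<close> is replaced by \<open>c\<close> in the second term. The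
  constant \<open>C\<close> is chosen before \<open>e\<close>, \<open>c\<close> and
  \<open>\<epsilon>\<close>, so that all three may later vary with the model.\<close>

lemma weighted_integral_bound:
  fixes g :: "real \<Rightarrow> real" and \<delta> \<theta> B :: real
  assumes g[measurable]: "g \<in> borel_measurable borel"
    and B: "\<And>y. y \<in> {0..1} \<Longrightarrow> \<bar>g y\<bar> \<le> B"
    and \<theta>: "0 < \<theta>" and \<delta>: "\<theta> / (1 + \<theta>) < \<delta>"
  obtains C where "0 \<le> C" and
    "\<And>e c \<epsilon>. e \<in> borel_measurable borel \<Longrightarrow> 0 < \<epsilon> \<Longrightarrow> 0 \<le> c \<Longrightarrow> (\<And>y. 0 \<le> y \<Longrightarrow> 0 \<le> e y \<and> e y \<le> c) \<Longrightarrow>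
      (\<integral>\<^sup>+y\<in>{0..}. ennreal (\<bar>g y\<bar> * e y) \<partial>lborel) \<le>
      ennreal \<epsilon> * (\<integral>\<^sup>+y\<in>{0..}. ennreal (\<bar>y powr \<delta> * g y\<bar> powr (1 + \<theta>) * e y) \<partial>lborel)
      + ennreal (c * (C + C * \<epsilon> powr (- 1 / \<theta>)))"
proof -
  \<comment> \<open>With \<open>v = y powr (- \<delta>)\<close> the second Young summand is a
    multiple of \<open>y powr (- q)\<close>. The lower bound on \<open>\<delta>\<close> says exactly
    that \<open>q > 1\<close>, that is, integrability at infinity.\<close>
  define q where "q = \<delta> * ((1 + \<theta>) / \<theta>)"
  have q: "1 < q"
    using \<theta> \<delta> by (simp add: q_def field_simps)
  define C where "C = max B (1 / (q - 1))"
  have C: "0 \<le> C" "B \<le> C" "1 / (q - 1) \<le> C"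
    using q by (auto simp: C_def le_max_iff_disj)
  have B0: "0 \<le> B"
    using B[of 0] by simp
  show ?thesis
  proof (rule that[OF C(1)])
    fix e :: "real \<Rightarrow> real" and c \<epsilon> :: real
    assume e[measurable]: "e \<in> borel_measurable borel" and \<epsilon>: "0 < \<epsilon>" and c: "0 \<le> c"
      and ec: "\<And>y. 0 \<le> y \<Longrightarrow> 0 \<le> e y \<and> e y \<le> c"
    let ?\<phi> = "\<lambda>y. \<bar>y powr \<delta> * g y\<bar> powr (1 + \<theta>) * e y"
    let ?k = "\<epsilon> powr (- 1 / \<theta>)"
    \<comment> \<open>Both ranges contain the point 1, which only enlarges the right-hand
      side.\<close>
    have pt: "ennreal (\<bar>g y\<bar> * e y) * indicator {0..} y \<le>
        ennreal \<epsilon> * (ennreal (?\<phi> y) * indicator {0..} y) +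
        (ennreal (c * B) * indicator {0..1} y + ennreal (c * ?k) * (ennreal (y powr (- q)) * indicator {1..} y))"
      for y
    proof -
      consider "y < 0" | "0 \<le> y" "y \<le> 1" | "1 < y"
        by linarith
      then show ?thesis
      proof cases
        case 1
        then show ?thesis by simp
      next
        case 2
        have "\<bar>g y\<bar> * e y \<le> B * c"
          using 2 B[of y] ec[of y] by (intro mult_mono) auto
        then have "ennreal (\<bar>g y\<bar> * e y) \<le> ennreal (c * B)"
          by (simp add: mult.commute ennreal_leI)
        then show ?thesis
          using 2 by (simp add: add_increasing add_increasing2)
      next
        case 3
        have "\<bar>g y\<bar> = \<bar>y powr \<delta> * g y\<bar> * y powr (- \<delta>)"
          using 3 by (simp add: abs_mult powr_minus field_simps)
        also have "\<dots> \<le> \<epsilon> * \<bar>y powr \<delta> * g y\<bar> powr (1 + \<theta>) + ?k * (y powr (- \<delta>)) powr ((1 + \<theta>) / \<theta>)"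
          using \<epsilon> \<theta> by (intro young_split) auto
        also have "(y powr (- \<delta>)) powr ((1 + \<theta>) / \<theta>) = y powr (- q)"
          by (simp add: powr_powr q_def)
        finally have "\<bar>g y\<bar> * e y \<le> (\<epsilon> * \<bar>y powr \<delta> * g y\<bar> powr (1 + \<theta>) + ?k * y powr (- q)) * e y"
          using ec[of y] 3 by (intro mult_right_mono) auto
        also have "\<dots> = \<epsilon> * ?\<phi> y + ?k * y powr (- q) * e y"
          by (simp add: algebra_simps)
        also have "\<dots> \<le> \<epsilon> * ?\<phi> y + ?k * y powr (- q) * c"
          using ec[of y] 3 by (intro add_left_mono mult_left_mono) auto
        finally have "ennreal (\<bar>g y\<bar> * e y) \<le> ennreal (\<epsilon> * ?\<phi> y + c * ?k * y powr (- q))"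
          by (simp add: ennreal_leI mult_ac)
        also have "\<dots> = ennreal \<epsilon> * ennreal (?\<phi> y) + ennreal (c * ?k) * ennreal (y powr (- q))"
          using \<epsilon> c ec[of y] 3 by (simp add: ennreal_mult ennreal_plus)
        finally show ?thesis
          using 3 by simp
      qed
    qed
    have "(\<integral>\<^sup>+y\<in>{0..}. ennreal (\<bar>g y\<bar> * e y) \<partial>lborel) \<le>
        (\<integral>\<^sup>+y. ennreal \<epsilon> * (ennreal (?\<phi> y) * indicator {0..} y) +
        (ennreal (c * B) * indicator {0..1} y + ennreal (c * ?k) * (ennreal (y powr (- q)) * indicator {1..} y)) \<partial>lborel)"
      by (intro nn_integral_mono pt)
    also have "\<dots> = ennreal \<epsilon> * (\<integral>\<^sup>+y\<in>{0..}. ennreal (?\<phi> y) \<partial>lborel) +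
        (ennreal (c * B) + ennreal (c * ?k) * ennreal (1 / (q - 1)))"
      using q by (simp add: nn_integral_add nn_integral_cmult nn_integral_powr_atLeast_1)
    also have "ennreal (c * B) + ennreal (c * ?k) * ennreal (1 / (q - 1)) = ennreal (c * (B + 1 / (q - 1) * ?k))"
      using c B0 q by (simp add: ennreal_mult[symmetric] ennreal_plus[symmetric] algebra_simps del: ennreal_plus)
    also have "\<dots> \<le> ennreal (c * (C + C * ?k))"
      using C c by (intro ennreal_leI mult_left_mono add_mono mult_right_mono) auto
    finally show "(\<integral>\<^sup>+y\<in>{0..}. ennreal (\<bar>g y\<bar> * e y) \<partial>lborel) \<le>
        ennreal \<epsilon> * (\<integral>\<^sup>+y\<in>{0..}. ennreal (?\<phi> y) \<partial>lborel) + ennreal (c * (C + C * ?k))"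
      by (simp add: add_left_mono)
  qed
qed

section \<open>Local bounds, measurability and a primitive for the payoff derivative\<close>

lemma bounded_near_tendsto:
  fixes h :: "real \<Rightarrow> real"
  assumes "(h \<longlongrightarrow> l) F"
  shows "eventually (\<lambda>y. \<bar>h y\<bar> \<le> \<bar>l\<bar> + 1) F"
proof -
  have "eventually (\<lambda>y. dist (h y) l < 1) F"
    using assms by (rule tendstoD) simp
  then show ?thesis
    by eventually_elim (auto simp: dist_real_def)
qed

text \<open>Every point has one-sided limits of the derivative, by continuity or by the jump
  conditions, hence a punctured neighbourhood where the derivative is bounded. Bisection turns these
  local bounds into one on the compact interval.\<close>

lemma payoff_class_deriv_bounded:
  assumes f: "f \<in> payoff_class"
  shows "\<exists>C. \<forall>y\<in>{0..R}. \<bar>deriv f y\<bar> \<le> C"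
proof (cases "0 \<le> R")
  case True
  from f obtain S where S: "finite S" "S \<subseteq> {0<..}"
    and cont: "continuous_on ({0<..} - S) (deriv f)"
    and right: "\<And>s. s \<in> insert 0 S \<Longrightarrow> \<exists>l. (deriv f \<longlongrightarrow> l) (at_right s)"
    and left: "\<And>s. s \<in> S \<Longrightarrow> \<exists>l. (deriv f \<longlongrightarrow> l) (at_left s)"
    unfolding payoff_class_def by blast
  have loc: "\<exists>C. eventually (\<lambda>y. 0 \<le> y \<longrightarrow> \<bar>deriv f y\<bar> \<le> C) (at x)" if x: "0 \<le> x" for x
  proof -
    have l: "\<exists>C. eventually (\<lambda>y. 0 \<le> y \<longrightarrow> \<bar>deriv f y\<bar> \<le> C) (at_left x)"
    proof (cases "x \<in> S")
      case True
      then obtain l where "(deriv f \<longlongrightarrow> l) (at_left x)"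
        using left by blast
      from bounded_near_tendsto[OF this] show ?thesis
        by (auto elim: eventually_mono)
    next
      case False
      show ?thesis
      proof (cases "x = 0")
        case True
        \<comment> \<open>To the left of 0 there are only negative arguments, so the guarded bound
          holds vacuously.\<close>
        then have "eventually (\<lambda>y. \<not> 0 \<le> y) (at_left x)"
          by (auto simp: eventually_at_filter)
        then show ?thesis
          by (auto elim: eventually_mono)
      next
        case x0: False
        have "open ({0<..} - S)"
          using S by (intro open_Diff finite_imp_closed) auto
        then have "isCont (deriv f) x"
          using cont False x x0 by (auto simp: continuous_on_eq_continuous_at)
        then have "(deriv f \<longlongrightarrow> deriv f x) (at_left x)"
          unfolding isCont_def by (rule tendsto_mono[rotated]) (simp add: at_le)
        from bounded_near_tendsto[OF this] show ?thesis
          by (auto elim: eventually_mono)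
      qed
    qed
    have r: "\<exists>C. eventually (\<lambda>y. 0 \<le> y \<longrightarrow> \<bar>deriv f y\<bar> \<le> C) (at_right x)"
    proof (cases "x \<in> insert 0 S")
      case True
      then obtain l where "(deriv f \<longlongrightarrow> l) (at_right x)"
        using right by blast
      from bounded_near_tendsto[OF this] show ?thesis
        by (auto elim: eventually_mono)
    next
      case False
      have "open ({0<..} - S)"
        using S by (intro open_Diff finite_imp_closed) auto
      then have "isCont (deriv f) x"
        using cont False x by (auto simp: continuous_on_eq_continuous_at)
      then have "(deriv f \<longlongrightarrow> deriv f x) (at_right x)"
        unfolding isCont_def by (rule tendsto_mono[rotated]) (simp add: at_le)
      from bounded_near_tendsto[OF this] show ?thesis
        by (auto elim: eventually_mono)
    qed
    from l r obtain C1 C2 where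
      "eventually (\<lambda>y. 0 \<le> y \<longrightarrow> \<bar>deriv f y\<bar> \<le> C1) (at_left x)"
      "eventually (\<lambda>y. 0 \<le> y \<longrightarrow> \<bar>deriv f y\<bar> \<le> C2) (at_right x)"
      by blast
    then have "eventually (\<lambda>y. 0 \<le> y \<longrightarrow> \<bar>deriv f y\<bar> \<le> max C1 C2) (at x)"
      unfolding eventually_at_split by (auto elim: eventually_mono)
    then show ?thesis ..
  qed
  \<comment> \<open>The guard \<open>0 \<le> y\<close> belongs to the bisection predicate because
    the small intervals around a point near 0 may reach into the negative numbers.\<close>
  have "\<exists>C. \<forall>y. 0 \<le> y \<and> 0 \<le> y \<and> y \<le> R \<longrightarrow> \<bar>deriv f y\<bar> \<le> C"
    using True
  proof (induction rule: Bolzano[where P = "\<lambda>a b. \<exists>C. \<forall>y. 0 \<le> y \<and> a \<le> y \<and> y \<le> b \<longrightarrow> \<bar>deriv f y\<bar> \<le> C"])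
    case (trans a b c)
    then obtain C1 C2 where
      "\<forall>y. 0 \<le> y \<and> a \<le> y \<and> y \<le> b \<longrightarrow> \<bar>deriv f y\<bar> \<le> C1"
      "\<forall>y. 0 \<le> y \<and> b \<le> y \<and> y \<le> c \<longrightarrow> \<bar>deriv f y\<bar> \<le> C2"
      by blast
    then have "\<forall>y. 0 \<le> y \<and> a \<le> y \<and> y \<le> c \<longrightarrow> \<bar>deriv f y\<bar> \<le> max C1 C2"
      by (metis linear max.coboundedI1 max.coboundedI2)
    then show ?case by blast
  next
    case (local x)
    then obtain C where "eventually (\<lambda>y. 0 \<le> y \<longrightarrow> \<bar>deriv f y\<bar> \<le> C) (at x)"
      using loc by blast
    then obtain d where d: "d > 0" "\<And>y. y \<noteq> x \<Longrightarrow> dist y x < d \<Longrightarrow> 0 \<le> y \<Longrightarrow> \<bar>deriv f y\<bar> \<le> C"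
      unfolding eventually_at by auto
    \<comment> \<open>The neighbourhood omits \<open>x\<close> itself, where \<open>deriv f\<close>
      may take an unspecified value. That single value is put into the maximum.\<close>
    have "\<bar>deriv f y\<bar> \<le> max C \<bar>deriv f x\<bar>"
      if "a \<le> x \<and> x \<le> b \<and> b - a < d" "0 \<le> y \<and> a \<le> y \<and> y \<le> b" for a b y
      using that d(2)[of y] by (cases "y = x") (auto simp: dist_real_def max.coboundedI1)
    with d(1) show ?case by blast
  qed
  then show ?thesis
    unfolding Ball_def by simp
qed auto

text \<open>The derivative is continuous on an open set which misses only finitely many points of
  the half-line. The indicator cuts off negative arguments, where the payoff class imposes
  nothing.\<close>

lemma payoff_class_deriv_measurable:
  assumes f: "f \<in> payoff_class"
  shows "(\<lambda>y. indicat_real {0..} y * deriv f y) \<in> borel_measurable borel"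
proof -
  from f obtain S where S: "finite S" and cont: "continuous_on ({0<..} - S) (deriv f)"
    unfolding payoff_class_def by blast
  have "{0<..} - S \<in> sets borel"
    using S by (intro borel_open open_Diff finite_imp_closed) auto
  then have "(\<lambda>y. indicat_real ({0<..} - S) y *\<^sub>R deriv f y) \<in> borel_measurable borel"
    using cont by (rule borel_measurable_continuous_on_indicator)
  then show ?thesis
    by (rule measurable_discrete_difference[where X = "insert 0 S"])
       (use S in \<open>auto simp: countable_finite split: split_indicator\<close>)
qed

lemma set_integrable_bounded_Icc:
  fixes g :: "real \<Rightarrow> real"
  assumes [measurable]: "g \<in> borel_measurable borel" and "\<And>y. y \<in> {a..b} \<Longrightarrow> \<bar>g y\<bar> \<le> C"
  shows "set_integrable lborel {a..b} g"
  unfolding set_integrable_def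
proof (rule integrableI_bounded_set_indicator[where B = C])
  show "AE x in lborel. x \<in> {a..b} \<longrightarrow> norm (g x) \<le> C"
    using assms(2) by auto
qed (auto simp: emeasure_lborel_Icc_eq)

text \<open>The fundamental theorem tolerates finitely many points without a derivative as long as
  the primitive is continuous. Continuity of \<open>f\<close> is what excludes jump terms
  here.\<close>

lemma payoff_class_FTC:
  assumes f: "f \<in> payoff_class" and cont: "continuous_on {0..} f" and x: "0 \<le> x"
  shows "f x = f 0 + (LINT y:{0..x}|lborel. indicat_real {0..} y * deriv f y)"
proof -
  let ?g = "\<lambda>y. indicat_real {0..} y * deriv f y"
  from f obtain S where S: "finite S" and diff: "\<forall>x\<in>{0<..} - S. f differentiable (at x)"
    unfolding payoff_class_def by blast
  obtain C where "\<forall>y\<in>{0..x}. \<bar>deriv f y\<bar> \<le> C"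
    using payoff_class_deriv_bounded[OF f] by blast
  then have "set_integrable lborel {0..x} ?g"
    by (intro set_integrable_bounded_Icc[where C = C] payoff_class_deriv_measurable f) auto
  then have "(LINT y:{0..x}|lborel. ?g y) = integral {0..x} ?g"
    by (rule set_borel_integral_eq_integral)
  moreover have "(?g has_integral f x - f 0) {0..x}"
  proof (rule fundamental_theorem_of_calculus_interior_strong[OF S x])
    fix y assume "y \<in> {0<..<x} - S"
    then show "(f has_vector_derivative ?g y) (at y)"
      using diff by (simp add: has_real_derivative_iff_has_vector_derivative[symmetric] DERIV_deriv_iff_real_differentiable)
  qed (use cont in \<open>auto intro: continuous_on_subset\<close>)
  ultimately show ?thesis
    by (simp add: integral_unique)
qed

section \<open>Discounted claims and the layer cake formula\<close>

text \<open>Abstracts one model to its discount factor \<open>w\<close> and terminal asset value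
  \<open>Y\<close>, so that the original and all approximating models become instances. Then
  \<open>digital\<close> is the tail function of the image under \<open>Y\<close> of the measure
  with density \<open>w\<close>, which has mass at most 1.\<close>

locale discounted_claim = prob_space Q for Q :: "'a measure" +
  fixes w Y :: "'a \<Rightarrow> real"
  assumes w_measurable[measurable]: "w \<in> borel_measurable Q"
    and Y_measurable[measurable]: "Y \<in> borel_measurable Q"
    and w_bounds: "\<And>\<omega>. \<omega> \<in> space Q \<Longrightarrow> 0 \<le> w \<omega> \<and> w \<omega> \<le> 1"
    and Y_nonneg: "\<And>\<omega>. \<omega> \<in> space Q \<Longrightarrow> 0 \<le> Y \<omega>"
begin

definition digital :: "real \<Rightarrow> real" where
  "digital a = (LINT \<omega>|Q. w \<omega> * indicat_real {a<..} (Y \<omega>))"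

lemma integrable_weight: "integrable Q w"
  by (rule integrable_const_bound[where B = 1]) (use w_bounds in auto)

lemma integrable_digital: "integrable Q (\<lambda>\<omega>. w \<omega> * indicat_real {a<..} (Y \<omega>))"
  by (rule integrable_const_bound[where B = 1]) (use w_bounds in \<open>auto simp: indicator_def\<close>)

lemma digital_nonneg: "0 \<le> digital a"
  unfolding digital_def using w_bounds by (intro integral_nonneg_AE) auto

lemma digital_le_1: "digital a \<le> 1"
proof -
  have "digital a \<le> (LINT \<omega>|Q. 1)"
    unfolding digital_def
    by (intro integral_mono integrable_digital) (use w_bounds in \<open>auto simp: indicator_def\<close>)
  then show ?thesis
    by (simp add: prob_space)
qed

lemma digital_measurable[measurable]: "digital \<in> borel_measurable borel"
proof -
  have "mono (\<lambda>a. - digital a)"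
    unfolding digital_def
    by (intro monoI le_imp_neg_le integral_mono integrable_digital mult_left_mono)
       (use w_bounds in \<open>auto simp: indicator_def\<close>)
  from borel_measurable_mono[OF this] show ?thesis
    by simp
qed

lemma nn_integral_digital:
  "(\<integral>\<^sup>+\<omega>. ennreal (w \<omega>) * indicator {a<..} (Y \<omega>) \<partial>Q) = ennreal (digital a)"
proof -
  have "(\<integral>\<^sup>+\<omega>. ennreal (w \<omega>) * indicator {a<..} (Y \<omega>) \<partial>Q) =
      (\<integral>\<^sup>+\<omega>. ennreal (w \<omega> * indicat_real {a<..} (Y \<omega>)) \<partial>Q)"
    by (intro nn_integral_cong) (auto split: split_indicator)
  also have "\<dots> = ennreal (digital a)"
    unfolding digital_def using w_bounds
    by (intro nn_integral_eq_integral integrable_digital) auto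
  finally show ?thesis .
qed

text \<open>The inner integral runs over all \<open>y\<close> below \<open>Y \<omega>\<close>. By
  Tonelli the integration over \<open>\<omega>\<close> may be done first, and for fixed
  \<open>y\<close> it produces the digital price with strike \<open>y\<close>.\<close>

lemma nn_integral_layer_cake:
  fixes \<phi> :: "real \<Rightarrow> ennreal"
  assumes [measurable]: "\<phi> \<in> borel_measurable borel"
  shows "(\<integral>\<^sup>+\<omega>. ennreal (w \<omega>) * (\<integral>\<^sup>+y\<in>{0..Y \<omega>}. \<phi> y \<partial>lborel) \<partial>Q) =
    (\<integral>\<^sup>+y\<in>{0..}. \<phi> y * ennreal (digital y) \<partial>lborel)"
proof -
  interpret pair_sigma_finite Q lborel
    by (simp add: pair_sigma_finite_def sigma_finite_measure_axioms lborel.sigma_finite_measure_axioms)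
  have "(\<integral>\<^sup>+y\<in>{0..Y \<omega>}. \<phi> y \<partial>lborel) = (\<integral>\<^sup>+y. \<phi> y * indicator {0..} y * indicator {y<..} (Y \<omega>) \<partial>lborel)" for \<omega>
  proof (intro nn_integral_cong_AE)
    \<comment> \<open>The interval is closed while the digital payoff uses a strict inequality; they
      differ only at \<open>y = Y \<omega>\<close>, a Lebesgue null set.\<close>
    show "AE y in lborel. \<phi> y * indicator {0..Y \<omega>} y = \<phi> y * indicator {0..} y * indicator {y<..} (Y \<omega>)"
      using AE_lborel_singleton[of "Y \<omega>"] by eventually_elim (auto split: split_indicator)
  qed
  then have "(\<integral>\<^sup>+\<omega>. ennreal (w \<omega>) * (\<integral>\<^sup>+y\<in>{0..Y \<omega>}. \<phi> y \<partial>lborel) \<partial>Q) =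
      (\<integral>\<^sup>+\<omega>. (\<integral>\<^sup>+y. ennreal (w \<omega>) * (\<phi> y * indicator {0..} y * indicator {y<..} (Y \<omega>)) \<partial>lborel) \<partial>Q)"
    by (intro nn_integral_cong) (subst nn_integral_cmult; simp add: indicator_def[of "{_<..}"])
  also have "\<dots> = (\<integral>\<^sup>+y. (\<integral>\<^sup>+\<omega>. ennreal (w \<omega>) * (\<phi> y * indicator {0..} y * indicator {y<..} (Y \<omega>)) \<partial>Q) \<partial>lborel)"
    by (rule Fubini'[symmetric]) (measurable, simp add: indicator_def)
  also have "\<dots> = (\<integral>\<^sup>+y\<in>{0..}. \<phi> y * ennreal (digital y) \<partial>lborel)"
  proof (intro nn_integral_cong)
    fix y :: real
    have "(\<integral>\<^sup>+\<omega>. ennreal (w \<omega>) * (\<phi> y * indicator {0..} y * indicator {y<..} (Y \<omega>)) \<partial>Q) =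
        (\<integral>\<^sup>+\<omega>. \<phi> y * indicator {0..} y * (ennreal (w \<omega>) * indicator {y<..} (Y \<omega>)) \<partial>Q)"
      by (simp add: mult_ac)
    also have "\<dots> = \<phi> y * indicator {0..} y * ennreal (digital y)"
      by (subst nn_integral_cmult) (auto simp: nn_integral_digital)
    finally show "(\<integral>\<^sup>+\<omega>. ennreal (w \<omega>) * (\<phi> y * indicator {0..} y * indicator {y<..} (Y \<omega>)) \<partial>Q) =
        \<phi> y * ennreal (digital y) * indicator {0..} y"
      by (simp add: mult_ac)
  qed
  finally show ?thesis .
qed

text \<open>The signed version. The hypothesis \<open>fin\<close> is the integral of the absolute
  value over the product space, computed one section at a time, so Fubini applies and also supplies
  both integrability claims.\<close>

lemma integral_layer_cake:
  fixes g :: "real \<Rightarrow> real"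
  assumes g[measurable]: "g \<in> borel_measurable borel"
    and fin: "(\<integral>\<^sup>+y\<in>{0..}. ennreal (\<bar>g y\<bar> * digital y) \<partial>lborel) < \<infinity>"
  shows "set_integrable lborel {0..} (\<lambda>y. g y * digital y)"
    and "integrable Q (\<lambda>\<omega>. w \<omega> * (LINT y:{0..Y \<omega>}|lborel. g y))"
    and "(LINT \<omega>|Q. w \<omega> * (LINT y:{0..Y \<omega>}|lborel. g y)) = (LINT y:{0..}|lborel. g y * digital y)"
proof -
  interpret pair_sigma_finite Q lborel
    by (simp add: pair_sigma_finite_def sigma_finite_measure_axioms lborel.sigma_finite_measure_axioms)
  \<comment> \<open>Integrating \<open>h\<close> over \<open>y\<close> gives the integrand in
    \<open>\<omega>\<close> (see \<open>inner\<close>), integrating it over \<open>\<omega>\<close>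
    gives the integrand in \<open>y\<close> (see \<open>outer\<close>).\<close>
  define h where "h \<omega> y = w \<omega> * (g y * indicat_real {0..} y * indicat_real {y<..} (Y \<omega>))" for \<omega> y
  have h[measurable]: "case_prod h \<in> borel_measurable (Q \<Otimes>\<^sub>M lborel)"
    unfolding h_def by (measurable, simp add: indicator_def)
  have inner: "w \<omega> * (LINT y:{0..Y \<omega>}|lborel. g y) = (LINT y|lborel. h \<omega> y)" for \<omega>
  proof -
    have "(LINT y:{0..Y \<omega>}|lborel. g y) = (LINT y|lborel. g y * indicat_real {0..} y * indicat_real {y<..} (Y \<omega>))"
      unfolding set_lebesgue_integral_def
    proof (intro integral_cong_AE)
      show "AE y in lborel. indicat_real {0..Y \<omega>} y *\<^sub>R g y = g y * indicat_real {0..} y * indicat_real {y<..} (Y \<omega>)"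
        using AE_lborel_singleton[of "Y \<omega>"] by eventually_elim (auto split: split_indicator)
      show "(\<lambda>y. g y * indicat_real {0..} y * indicat_real {y<..} (Y \<omega>)) \<in> borel_measurable lborel"
        by (measurable, simp add: indicator_def)
    qed simp
    then show ?thesis
      by (simp add: h_def)
  qed
  have outer: "(LINT \<omega>|Q. h \<omega> y) = indicat_real {0..} y *\<^sub>R (g y * digital y)" for y
  proof -
    have "(LINT \<omega>|Q. h \<omega> y) = (LINT \<omega>|Q. g y * indicat_real {0..} y * (w \<omega> * indicat_real {y<..} (Y \<omega>)))"
      by (simp add: h_def mult_ac)
    then show ?thesis
      by (simp add: digital_def)
  qed
  have int: "integrable (Q \<Otimes>\<^sub>M lborel) (case_prod h)"
  proof (rule integrableI_bounded)
    have "(\<integral>\<^sup>+p. ennreal (norm (case_prod h p)) \<partial>(Q \<Otimes>\<^sub>M lborel)) =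
        (\<integral>\<^sup>+y. (\<integral>\<^sup>+\<omega>. ennreal \<bar>h \<omega> y\<bar> \<partial>Q) \<partial>lborel)"
      by (subst nn_integral_snd[symmetric]) auto
    also have "\<dots> = (\<integral>\<^sup>+y\<in>{0..}. ennreal (\<bar>g y\<bar> * digital y) \<partial>lborel)"
    proof (intro nn_integral_cong)
      fix y :: real
      have "(\<integral>\<^sup>+\<omega>. ennreal \<bar>h \<omega> y\<bar> \<partial>Q) =
          (\<integral>\<^sup>+\<omega>. ennreal \<bar>g y\<bar> * indicator {0..} y * (ennreal (w \<omega>) * indicator {y<..} (Y \<omega>)) \<partial>Q)"
        using w_bounds
        by (intro nn_integral_cong) (auto simp: h_def abs_mult ennreal_mult mult_ac split: split_indicator)
      also have "\<dots> = ennreal \<bar>g y\<bar> * indicator {0..} y * ennreal (digital y)"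
        by (subst nn_integral_cmult) (auto simp: nn_integral_digital)
      finally show "(\<integral>\<^sup>+\<omega>. ennreal \<bar>h \<omega> y\<bar> \<partial>Q) = ennreal (\<bar>g y\<bar> * digital y) * indicator {0..} y"
        by (simp add: ennreal_mult digital_nonneg mult_ac)
    qed
    finally show "(\<integral>\<^sup>+p. ennreal (norm (case_prod h p)) \<partial>(Q \<Otimes>\<^sub>M lborel)) < \<infinity>"
      using fin by simp
  qed (rule h)
  show "set_integrable lborel {0..} (\<lambda>y. g y * digital y)"
    unfolding set_integrable_def outer[symmetric] using int by (rule integrable_snd)
  show "integrable Q (\<lambda>\<omega>. w \<omega> * (LINT y:{0..Y \<omega>}|lborel. g y))"
    unfolding inner using int by (rule integrable_fst)
  show "(LINT \<omega>|Q. w \<omega> * (LINT y:{0..Y \<omega>}|lborel. g y)) = (LINT y:{0..}|lborel. g y * digital y)"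
    unfolding inner set_lebesgue_integral_def[of lborel "{0..}"] outer[symmetric]
    using int by (rule Fubini_integral[symmetric])
qed

end

section \<open>The dominating payoff as a nonnegative integral\<close>

lemma payoff_class_weight_measurable:
  assumes "f \<in> payoff_class"
  shows "(\<lambda>y. \<bar>y powr \<delta> * (indicat_real {0..} y * deriv f y)\<bar> powr p) \<in> borel_measurable borel"
proof -
  note [measurable] = payoff_class_deriv_measurable[OF assms]
  show ?thesis by measurable
qed

text \<open>The integrand is bounded on \<open>{0..x}\<close>, so the Bochner integral in the
  definition is a genuine one and not the default value 0. This makes the layer cake formula for
  nonnegative functions applicable.\<close>

lemma dominating_payoff_nn_integral:
  assumes f: "f \<in> payoff_class" and \<delta>: "0 \<le> \<delta>" and \<theta>: "- 1 \<le> \<theta>"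
  shows "ennreal (dominating_payoff f \<delta> \<theta> x) =
    (\<integral>\<^sup>+y\<in>{0..x}. ennreal (\<bar>y powr \<delta> * (indicat_real {0..} y * deriv f y)\<bar> powr (1 + \<theta>)) \<partial>lborel)"
proof -
  define \<psi> where "\<psi> y = \<bar>y powr \<delta> * (indicat_real {0..} y * deriv f y)\<bar> powr (1 + \<theta>)" for y
  obtain C where C: "\<forall>y\<in>{0..x}. \<bar>deriv f y\<bar> \<le> C"
    using payoff_class_deriv_bounded[OF f] by blast
  have int: "set_integrable lborel {0..x} \<psi>"
  proof (rule set_integrable_bounded_Icc)
    show "\<psi> \<in> borel_measurable borel"
      unfolding \<psi>_def by (rule payoff_class_weight_measurable[OF f])
  next
    fix y assume y: "y \<in> {0..x}"
    have "\<bar>y powr \<delta> * deriv f y\<bar> \<le> x powr \<delta> * C"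
      using C y \<delta> by (auto simp: abs_mult intro!: mult_mono powr_mono2)
    then show "\<bar>\<psi> y\<bar> \<le> (x powr \<delta> * C) powr (1 + \<theta>)"
      using y \<theta> by (simp add: \<psi>_def powr_mono2)
  qed
  have "dominating_payoff f \<delta> \<theta> x = (LINT y:{0..x}|lborel. \<psi> y)"
    unfolding dominating_payoff_def by (intro set_lebesgue_integral_cong) (auto simp: \<psi>_def)
  also have "ennreal \<dots> = (\<integral>\<^sup>+y. ennreal (indicat_real {0..x} y *\<^sub>R \<psi> y) \<partial>lborel)"
    unfolding set_lebesgue_integral_def using int
    by (intro nn_integral_eq_integral[symmetric]) (auto simp: set_integrable_def \<psi>_def)
  also have "\<dots> = (\<integral>\<^sup>+y\<in>{0..x}. ennreal (\<psi> y) \<partial>lborel)"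
    by (intro nn_integral_cong) (auto split: split_indicator)
  finally show ?thesis
    unfolding \<psi>_def .
qed

lemma dominating_payoff_nonneg: "0 \<le> dominating_payoff f \<delta> \<theta> x"
  unfolding dominating_payoff_def set_lebesgue_integral_def
  by (intro integral_nonneg_AE) auto

lemma dominating_payoff_mono:
  assumes "f \<in> payoff_class" "0 \<le> \<delta>" "- 1 \<le> \<theta>" "x \<le> z"
  shows "dominating_payoff f \<delta> \<theta> x \<le> dominating_payoff f \<delta> \<theta> z"
proof -
  have "ennreal (dominating_payoff f \<delta> \<theta> x) \<le> ennreal (dominating_payoff f \<delta> \<theta> z)"
    unfolding dominating_payoff_nn_integral[OF assms(1-3)]
    using assms(4) by (intro nn_integral_mono mult_left_mono) (auto simp: indicator_def)
  then show ?thesis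
    by (simp add: dominating_payoff_nonneg)
qed

section \<open>Prices as integrals against the digital price\<close>

context discounted_claim
begin

text \<open>Insert the fundamental theorem at \<open>Y \<omega>\<close> into the expectation and
  apply the layer cake formula to the integral of the derivative.\<close>

lemma claim_price:
  assumes f: "f \<in> payoff_class" "continuous_on {0..} f"
    and fin: "(\<integral>\<^sup>+y\<in>{0..}. ennreal (\<bar>indicat_real {0..} y * deriv f y\<bar> * digital y) \<partial>lborel) < \<infinity>"
  shows "(LINT \<omega>|Q. w \<omega> * f (Y \<omega>)) = f 0 * (LINT \<omega>|Q. w \<omega>) +
    (LINT y:{0..}|lborel. (indicat_real {0..} y * deriv f y) * digital y)"
proof -
  let ?g = "\<lambda>y. indicat_real {0..} y * deriv f y"
  note layer = integral_layer_cake[OF payoff_class_deriv_measurable[OF f(1)] fin]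
  have "(LINT \<omega>|Q. w \<omega> * f (Y \<omega>)) =
      (LINT \<omega>|Q. f 0 * w \<omega> + w \<omega> * (LINT y:{0..Y \<omega>}|lborel. ?g y))"
    using payoff_class_FTC[OF f Y_nonneg]
    by (intro Bochner_Integration.integral_cong refl) (simp add: algebra_simps)
  also have "\<dots> = f 0 * (LINT \<omega>|Q. w \<omega>) + (LINT \<omega>|Q. w \<omega> * (LINT y:{0..Y \<omega>}|lborel. ?g y))"
    using integrable_weight layer(2) by simp
  finally show ?thesis
    unfolding layer(3) .
qed

text \<open>Layer cake for the dominating payoff. It translates a bound on the price of that payoff
  into a weighted bound on the digital price.\<close>

lemma nn_integral_dominating_payoff:
  assumes f: "f \<in> payoff_class" and \<delta>: "0 \<le> \<delta>" and \<theta>: "- 1 \<le> \<theta>"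
  shows "(\<integral>\<^sup>+\<omega>. ennreal (w \<omega> * dominating_payoff f \<delta> \<theta> (Y \<omega>)) \<partial>Q) =
    (\<integral>\<^sup>+y\<in>{0..}. ennreal (\<bar>y powr \<delta> * (indicat_real {0..} y * deriv f y)\<bar> powr (1 + \<theta>) * digital y) \<partial>lborel)"
proof -
  note [measurable] = payoff_class_weight_measurable[OF f]
  have "(\<integral>\<^sup>+\<omega>. ennreal (w \<omega> * dominating_payoff f \<delta> \<theta> (Y \<omega>)) \<partial>Q) =
     (\<integral>\<^sup>+\<omega>. ennreal (w \<omega>) * (\<integral>\<^sup>+y\<in>{0..Y \<omega>}. ennreal (\<bar>y powr \<delta> * (indicat_real {0..} y * deriv f y)\<bar> powr (1 + \<theta>)) \<partial>lborel) \<partial>Q)"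
    using w_bounds dominating_payoff_nonneg
    by (intro nn_integral_cong) (simp add: ennreal_mult dominating_payoff_nn_integral[OF assms, symmetric])
  also have "\<dots> = (\<integral>\<^sup>+y\<in>{0..}. ennreal (\<bar>y powr \<delta> * (indicat_real {0..} y * deriv f y)\<bar> powr (1 + \<theta>)) * ennreal (digital y) \<partial>lborel)"
    by (rule nn_integral_layer_cake) measurable
  finally show ?thesis
    by (simp add: ennreal_mult digital_nonneg)
qed

text \<open>Split at \<open>a\<close>. Below, the payoff is at most its value at \<open>a\<close> by
  monotonicity, and discounting and total mass contribute factors at most 1; above, the tail bound
  applies. The result depends on the model only through \<open>K\<close>, so a common tail bound
  gives a common price bound.\<close>

lemma nn_integral_dominating_payoff_le:
  assumes f: "f \<in> payoff_class" and \<delta>: "0 \<le> \<delta>" and \<theta>: "- 1 \<le> \<theta>"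
    and int: "integrable Q (\<lambda>\<omega>. dominating_payoff f \<delta> \<theta> (Y \<omega>))"
    and tail: "(LINT \<omega>|Q. w \<omega> * dominating_payoff f \<delta> \<theta> (Y \<omega>) * indicat_real {a<..} (Y \<omega>)) \<le> K"
  shows "(\<integral>\<^sup>+\<omega>. ennreal (w \<omega> * dominating_payoff f \<delta> \<theta> (Y \<omega>)) \<partial>Q) \<le> ennreal (dominating_payoff f \<delta> \<theta> a + K)"
proof -
  let ?F = "dominating_payoff f \<delta> \<theta>"
  have int1: "integrable Q (\<lambda>\<omega>. w \<omega> * ?F (Y \<omega>))"
  proof (rule Bochner_Integration.integrable_bound[OF int])
    show "(\<lambda>\<omega>. w \<omega> * ?F (Y \<omega>)) \<in> borel_measurable Q"
      using borel_measurable_integrable[OF int] by simp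
    show "AE \<omega> in Q. norm (w \<omega> * ?F (Y \<omega>)) \<le> norm (?F (Y \<omega>))"
      using w_bounds by (auto simp: abs_mult intro!: mult_left_le_one_le)
  qed
  have int2: "integrable Q (\<lambda>\<omega>. w \<omega> * ?F (Y \<omega>) * indicat_real {a<..} (Y \<omega>))"
  proof (rule Bochner_Integration.integrable_bound[OF int1])
    show "(\<lambda>\<omega>. w \<omega> * ?F (Y \<omega>) * indicat_real {a<..} (Y \<omega>)) \<in> borel_measurable Q"
      using borel_measurable_integrable[OF int1] by simp
  qed (auto split: split_indicator)
  have "(\<integral>\<^sup>+\<omega>. ennreal (w \<omega> * ?F (Y \<omega>)) \<partial>Q) = ennreal (LINT \<omega>|Q. w \<omega> * ?F (Y \<omega>))"
    using w_bounds dominating_payoff_nonneg by (intro nn_integral_eq_integral int1) auto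
  also have "(LINT \<omega>|Q. w \<omega> * ?F (Y \<omega>)) \<le> (LINT \<omega>|Q. ?F a + w \<omega> * ?F (Y \<omega>) * indicat_real {a<..} (Y \<omega>))"
  proof (intro integral_mono int1 Bochner_Integration.integrable_add int2)
    fix \<omega> assume \<omega>: "\<omega> \<in> space Q"
    show "w \<omega> * ?F (Y \<omega>) \<le> ?F a + w \<omega> * ?F (Y \<omega>) * indicat_real {a<..} (Y \<omega>)"
    proof (cases "a < Y \<omega>")
      case False
      then have "?F (Y \<omega>) \<le> ?F a"
        by (intro dominating_payoff_mono f \<delta> \<theta>) auto
      moreover have "w \<omega> * ?F (Y \<omega>) \<le> ?F (Y \<omega>)"
        using w_bounds[OF \<omega>] dominating_payoff_nonneg by (intro mult_left_le_one_le) auto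
      ultimately show ?thesis
        using False by simp
    qed (simp add: dominating_payoff_nonneg)
  qed simp
  also have "\<dots> \<le> ?F a + K"
    using tail int2 by (simp add: prob_space)
  finally show ?thesis
    by (simp add: ennreal_leI)
qed

end

section \<open>Markets as discounted claims\<close>

text \<open>The filtration is generated by measurable stock prices, so adapted processes are
  measurable for \<open>Q\<close>. The bond starts at 1 and increases, which puts the discount
  factor between 0 and 1.\<close>

lemma discounted_claim_market:
  assumes T: "0 < T" and M: "market T M" and Q: "equivalent_martingale_measure T M Q"
    and X: "underlying_asset T M X"
  shows "discounted_claim Q (\<lambda>\<omega>. inverse (bond M T \<omega>)) (X T)"
proof -
  have sets: "sets Q = sets (physical M)" and "prob_space Q"
    using Q by (auto simp: equivalent_martingale_measure_def)
  then interpret prob_space Q by simp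
  have sp: "space Q = space (physical M)"
    using sets by (rule sets_eq_imp_space_eq)
  let ?G = "\<Union>s\<in>{0..T}. {stock M s -` A \<inter> space (physical M) |A. A \<in> sets borel}"
  have "?G \<subseteq> sets (physical M)"
    using M by (auto simp: market_def intro: measurable_sets)
  then have sub: "sets (stock_filtration M T) \<subseteq> sets (physical M)"
    unfolding stock_filtration_def
    using sets.sigma_sets_subset[of ?G "physical M"] by (subst sets_measure_of) auto
  have meas: "h \<in> borel_measurable Q" if "h \<in> borel_measurable (stock_filtration M T)" for h :: "'a \<Rightarrow> real"
  proof (rule measurable_from_subalg[OF _ that])
    show "subalgebra Q (stock_filtration M T)"
      using sub by (auto simp: subalgebra_def sets sp stock_filtration_def space_measure_of_conv)
  qed
  show ?thesis
  proof
    show "(\<lambda>\<omega>. inverse (bond M T \<omega>)) \<in> borel_measurable Q"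
      using M T by (intro borel_measurable_inverse meas) (auto simp: market_def)
    show "X T \<in> borel_measurable Q"
      using X T by (intro meas) (auto simp: underlying_asset_def)
    fix \<omega> assume \<omega>: "\<omega> \<in> space Q"
    then show "0 \<le> X T \<omega>"
      using X by (auto simp: underlying_asset_def sp)
    have "bond M 0 \<omega> = 1" "mono_on {0..T} (\<lambda>t. bond M t \<omega>)"
      using M \<omega> by (auto simp: market_def sp)
    moreover from this(2) have "bond M 0 \<omega> \<le> bond M T \<omega>"
      using T by (auto dest: mono_onD[where r = 0 and s = T])
    ultimately have "1 \<le> bond M T \<omega>"
      by simp
    then show "0 \<le> inverse (bond M T \<omega>) \<and> inverse (bond M T \<omega>) \<le> 1"
      by (simp add: inverse_le_1_iff)
  qed
qed

section \<open>The first-order expansion of claim prices\<close>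

theorem theorem3p1:
  fixes T \<beta> \<kappa> \<delta> \<theta> :: real
    and M :: "'a market" and Q :: "'a measure" and X :: "real \<Rightarrow> 'a \<Rightarrow> real"
    and Mn :: "nat \<Rightarrow> 'b market" and Qn :: "nat \<Rightarrow> 'b measure"
    and Xn :: "nat \<Rightarrow> real \<Rightarrow> 'b \<Rightarrow> real"
    and A :: "nat \<Rightarrow> real \<Rightarrow> real" and f :: "real \<Rightarrow> real"
  assumes "0 < T"
    and "market T M"
    and "equivalent_martingale_measure T M Q"
    and "underlying_asset T M X"
    and "\<And>n. n \<ge> 1 \<Longrightarrow> market T (Mn n)"
    and "\<And>n. n \<ge> 1 \<Longrightarrow> equivalent_martingale_measure T (Mn n) (Qn n)"
    and "\<And>n. n \<ge> 1 \<Longrightarrow> underlying_asset T (Mn n) (Xn n)"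
    and "0 < \<beta>" and "\<beta> < \<kappa>"
    and "f \<in> joint_payoff_class T M Q X Mn Qn Xn"
    and "continuous_on {0..} f"
    and "(\<lambda>n. bond_price T (Mn n) (Qn n) - bond_price T M Q) \<in> o(\<lambda>n. real n powr (- \<beta>))"
    and "\<And>n. n \<ge> 1 \<Longrightarrow> set_borel_measurable lborel {0..} (A n)"
    and "digital_expansion T M Q X Mn Qn Xn A \<beta> \<kappa>"
    and "\<theta> > \<beta> / (\<kappa> - \<beta>)" and "\<delta> > \<theta> / (1 + \<theta>)"
    and "(\<integral>\<^sup>+ \<omega>. ennreal (inverse (bond M T \<omega>) * dominating_payoff f \<delta> \<theta> (X T \<omega>)) \<partial>Q) < \<infinity>"
    and "(SUP n\<in>{1..}. \<integral>\<^sup>+ a\<in>{0..}. ennreal (\<bar>a powr \<delta> * deriv f a\<bar> powr (1 + \<theta>) * \<bar>A n a\<bar>) \<partial>lborel) < \<infinity>"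
    and "uniformly_integrable_pair T Mn Qn Xn (dominating_payoff f \<delta> \<theta>)"
  shows "(\<forall>n\<ge>1. set_integrable lborel {0..} (\<lambda>a. deriv f a * A n a)) \<and>
    (\<lambda>n. payoff_price T (Mn n) (Qn n) (Xn n) f -
          (payoff_price T M Q X f + 1 / real n powr \<beta> * (LINT a:{0..}|lborel. deriv f a * A n a)))
      \<in> o(\<lambda>n. real n powr (- \<beta>))"
proof -
  define b where "b = bond_price T M Q"
  define bn where "bn n = bond_price T (Mn n) (Qn n)" for n
  define D where "D = digital_price T M Q X"
  define Dn where "Dn n = digital_price T (Mn n) (Qn n) (Xn n)" for n
  define g where "g y = indicat_real {0..} y * deriv f y" for y
  define \<psi> where "\<psi> y = \<bar>y powr \<delta> * g y\<bar> powr (1 + \<theta>)" for y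
  define A' where "A' n y = indicat_real {0..} y * A n y" for n y
  \<comment> \<open>The remainder of the digital expansion. Like \<open>g\<close> and
    \<open>A'\<close> it is cut off at 0, since the assumptions speak of nonnegative strikes
    only.\<close>
  define E where "E n y = indicat_real {0..} y * (Dn n y - D y - A' n y / real n powr \<beta>)" for n y

  \<comment> \<open>\<open>\<beta> < \<kappa>\<close> makes the threshold for
    \<open>\<theta>\<close> positive; then the threshold for \<open>\<delta>\<close> is positive
    too.\<close>
  have \<theta>0: "0 < \<theta>" and \<delta>0: "0 < \<delta>"
  proof -
    have "0 < \<beta> / (\<kappa> - \<beta>)"
      using assms(8,9) by simp
    then show "0 < \<theta>"
      using assms(15) by linarith
    then have "0 < \<theta> / (1 + \<theta>)"
      by simp
    then show "0 < \<delta>"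
      using assms(16) by linarith
  qed
  have f: "f \<in> payoff_class"
    using assms(10) by (auto simp: joint_payoff_class_def payoff_class_of_def)

  interpret C: discounted_claim Q "\<lambda>\<omega>. inverse (bond M T \<omega>)" "X T"
    using assms(1-4) by (rule discounted_claim_market)
  have Cn: "discounted_claim (Qn n) (\<lambda>\<omega>. inverse (bond (Mn n) T \<omega>)) (Xn n T)" if "1 \<le> n" for n
    using assms(1) assms(5-7)[OF that] by (rule discounted_claim_market)
  have D_eq: "D = C.digital"
    by (simp add: D_def digital_price_def payoff_price_def C.digital_def fun_eq_iff)
  have Dn_eq: "Dn n = discounted_claim.digital (Qn n) (\<lambda>\<omega>. inverse (bond (Mn n) T \<omega>)) (Xn n T)" if "1 \<le> n" for n
    by (simp add: Dn_def digital_price_def payoff_price_def discounted_claim.digital_def[OF Cn[OF that]] fun_eq_iff)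

  have g_meas[measurable]: "g \<in> borel_measurable borel"
    unfolding g_def by (rule payoff_class_deriv_measurable[OF f])
  have \<psi>_meas[measurable]: "\<psi> \<in> borel_measurable borel"
    unfolding \<psi>_def by measurable
  have D_meas[measurable]: "D \<in> borel_measurable borel"
    unfolding D_eq by (rule C.digital_measurable)
  have D_bounds: "0 \<le> D y" "D y \<le> 1" for y
    unfolding D_eq by (rule C.digital_nonneg C.digital_le_1)+
  have Dn_meas: "Dn n \<in> borel_measurable borel" if "1 \<le> n" for n
    unfolding Dn_eq[OF that] by (rule discounted_claim.digital_measurable[OF Cn[OF that]])
  have Dn_bounds: "0 \<le> Dn n y" "Dn n y \<le> 1" if "1 \<le> n" for n y
    unfolding Dn_eq[OF that]
    by (rule discounted_claim.digital_nonneg[OF Cn[OF that]] discounted_claim.digital_le_1[OF Cn[OF that]])+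
  have A'_meas: "A' n \<in> borel_measurable borel" if "1 \<le> n" for n
    using assms(13)[OF that] by (simp add: set_borel_measurable_def A'_def[abs_def])
  have E_meas: "E n \<in> borel_measurable borel" if "1 \<le> n" for n
  proof -
    note [measurable] = Dn_meas[OF that] A'_meas[OF that]
    show ?thesis
      unfolding E_def by measurable
  qed

  obtain B where "\<forall>y\<in>{0..1}. \<bar>deriv f y\<bar> \<le> B"
    using payoff_class_deriv_bounded[OF f] by blast
  then have B: "\<bar>g y\<bar> \<le> B" if "y \<in> {0..1}" for y
    using that by (simp add: g_def)
  obtain C where C: "0 \<le> C" and bound: "\<And>e c \<epsilon>. e \<in> borel_measurable borel \<Longrightarrow> 0 < \<epsilon> \<Longrightarrow> 0 \<le> c \<Longrightarrow>
      (\<And>y. 0 \<le> y \<Longrightarrow> 0 \<le> e y \<and> e y \<le> c) \<Longrightarrow>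
      (\<integral>\<^sup>+y\<in>{0..}. ennreal (\<bar>g y\<bar> * e y) \<partial>lborel) \<le>
      ennreal \<epsilon> * (\<integral>\<^sup>+y\<in>{0..}. ennreal (\<psi> y * e y) \<partial>lborel) + ennreal (c * (C + C * \<epsilon> powr (- 1 / \<theta>)))"
    by (rule weighted_integral_bound[OF g_meas B \<theta>0 assms(16), folded \<psi>_def]; (assumption | (rule that; blast)))

  \<comment> \<open>Weighted bounds, uniform in the model, for the three constituents of the
    remainder\<close>
  obtain K1 where K1: "0 \<le> K1" "(\<integral>\<^sup>+y\<in>{0..}. ennreal (\<psi> y * D y) \<partial>lborel) \<le> ennreal K1"
  proof -
    have "(\<integral>\<^sup>+y\<in>{0..}. ennreal (\<psi> y * D y) \<partial>lborel) < \<infinity>"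
      using assms(17) C.nn_integral_dominating_payoff[OF f, of \<delta> \<theta>] \<theta>0 \<delta>0
      by (simp add: \<psi>_def g_def D_eq)
    then show ?thesis
      by (intro that[of "enn2real (\<integral>\<^sup>+y\<in>{0..}. ennreal (\<psi> y * D y) \<partial>lborel)"]) auto
  qed
  obtain K2 where K2: "0 \<le> K2" "\<And>n. 1 \<le> n \<Longrightarrow> (\<integral>\<^sup>+y\<in>{0..}. ennreal (\<psi> y * Dn n y) \<partial>lborel) \<le> ennreal K2"
  proof -
    let ?F = "dominating_payoff f \<delta> \<theta>"
    let ?t = "\<lambda>a n. LINT \<omega>|Qn n. inverse (bond (Mn n) T \<omega>) * ?F (Xn n T \<omega>) * indicat_real {a<..} (Xn n T \<omega>)"
    \<comment> \<open>Any fixed tolerance serves. With 1, the tail beyond \<open>a\<close> costs at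
      most 1 and the rest at most \<open>?F a\<close>, whence \<open>K2 = ?F a + 1\<close>.\<close>
    from assms(19) obtain a where a: "(SUP n\<in>{1..}. ereal \<bar>?t a n\<bar>) < ereal 1"
      unfolding uniformly_integrable_pair_def using zero_less_one by blast
    show ?thesis
    proof (rule that[of "?F a + 1"])
      fix n :: nat assume n: "1 \<le> n"
      interpret Cn: discounted_claim "Qn n" "\<lambda>\<omega>. inverse (bond (Mn n) T \<omega>)" "Xn n T"
        using n by (rule Cn)
      have "ereal \<bar>?t a n\<bar> \<le> (SUP n\<in>{1..}. ereal \<bar>?t a n\<bar>)"
        using n by (intro SUP_upper) auto
      then have "ereal \<bar>?t a n\<bar> < ereal 1"
        using a by (rule le_less_trans)
      then have tail: "?t a n \<le> 1"
        by simp
      have "integrable (Qn n) (\<lambda>\<omega>. ?F (Xn n T \<omega>))"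
        using assms(19) n by (auto simp: uniformly_integrable_pair_def payoff_class_of_def)
      from Cn.nn_integral_dominating_payoff_le[OF f _ _ this tail]
        Cn.nn_integral_dominating_payoff[OF f, of \<delta> \<theta>]
      show "(\<integral>\<^sup>+y\<in>{0..}. ennreal (\<psi> y * Dn n y) \<partial>lborel) \<le> ennreal (?F a + 1)"
        using \<theta>0 \<delta>0 by (simp add: \<psi>_def g_def Dn_eq[OF n])
    qed (simp add: dominating_payoff_nonneg)
  qed
  obtain K3 where K3: "0 \<le> K3" "\<And>n. 1 \<le> n \<Longrightarrow> (\<integral>\<^sup>+y\<in>{0..}. ennreal (\<psi> y * \<bar>A' n y\<bar>) \<partial>lborel) \<le> ennreal K3"
  proof -
    let ?S = "SUP n\<in>{1..}. \<integral>\<^sup>+ a\<in>{0..}. ennreal (\<bar>a powr \<delta> * deriv f a\<bar> powr (1 + \<theta>) * \<bar>A n a\<bar>) \<partial>lborel"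
    show ?thesis
    proof (rule that[of "enn2real ?S"])
      fix n :: nat assume n: "1 \<le> n"
      have "(\<integral>\<^sup>+y\<in>{0..}. ennreal (\<psi> y * \<bar>A' n y\<bar>) \<partial>lborel) =
          (\<integral>\<^sup>+ a\<in>{0..}. ennreal (\<bar>a powr \<delta> * deriv f a\<bar> powr (1 + \<theta>) * \<bar>A n a\<bar>) \<partial>lborel)"
        by (intro nn_integral_cong) (auto simp: \<psi>_def g_def A'_def split: split_indicator)
      also have "\<dots> \<le> ?S"
        using n by (intro SUP_upper) auto
      also have "?S = ennreal (enn2real ?S)"
        using assms(18) by simp
      finally show "(\<integral>\<^sup>+y\<in>{0..}. ennreal (\<psi> y * \<bar>A' n y\<bar>) \<partial>lborel) \<le> ennreal (enn2real ?S)" .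
    qed simp
  qed

  \<comment> \<open>Size and integrability of the remainder\<close>
  obtain c where c: "0 \<le> c" and E_bound: "\<And>n y. 1 \<le> n \<Longrightarrow> \<bar>E n y\<bar> \<le> c * real n powr (- \<kappa>)"
  proof -
    from assms(14) obtain R c where
      R: "\<forall>n\<ge>1. \<forall>a\<ge>0. \<bar>R n a\<bar> \<le> c" and
      exp: "\<forall>n\<ge>1. \<forall>a\<ge>0. Dn n a = D a + A n a / real n powr \<beta> + R n a * real n powr (- \<kappa>)"
      unfolding digital_expansion_def D_def Dn_def by blast
    \<comment> \<open>Nonnegativity of the bound is read off at one admissible index and
      strike.\<close>
    have c: "0 \<le> c"
      using R[rule_format, of 1 0] by simp
    show ?thesis
    proof (rule that[OF c])
      fix n :: nat and y :: real assume n: "1 \<le> n"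
      show "\<bar>E n y\<bar> \<le> c * real n powr (- \<kappa>)"
      proof (cases "0 \<le> y")
        case True
        then have "E n y = R n y * real n powr (- \<kappa>)"
          using exp n by (simp add: E_def A'_def)
        then show ?thesis
          using R n True by (auto simp: abs_mult intro!: mult_right_mono)
      qed (simp add: E_def c)
    qed
  qed

  \<comment> \<open>A plain triangle inequality: no decay in \<open>n\<close> is claimed for the
    weighted integral, which the small factor \<open>\<epsilon>\<close> will compensate.\<close>
  have \<psi>_E: "(\<integral>\<^sup>+y\<in>{0..}. ennreal (\<psi> y * \<bar>E n y\<bar>) \<partial>lborel) \<le> ennreal (K1 + K2 + K3)" if n: "1 \<le> n" for n
  proof -
    note [measurable] = Dn_meas[OF n] A'_meas[OF n]
    have "ennreal (\<psi> y * \<bar>E n y\<bar>) \<le> ennreal (\<psi> y * D y) + ennreal (\<psi> y * Dn n y) + ennreal (\<psi> y * \<bar>A' n y\<bar>)"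
      for y
    proof -
      have "1 \<le> real n powr \<beta>"
        using n assms(8) by (simp add: ge_one_powr_ge_zero)
      then have "\<bar>A' n y\<bar> / real n powr \<beta> \<le> \<bar>A' n y\<bar> / 1"
        using n by (intro divide_left_mono) auto
      then have "\<bar>A' n y / real n powr \<beta>\<bar> \<le> \<bar>A' n y\<bar>"
        by (simp add: abs_divide)
      then have "\<bar>Dn n y - D y - A' n y / real n powr \<beta>\<bar> \<le> D y + Dn n y + \<bar>A' n y\<bar>"
        using D_bounds[of y] Dn_bounds[OF n, of y] by linarith
      then have "\<bar>E n y\<bar> \<le> D y + Dn n y + \<bar>A' n y\<bar>"
        using D_bounds[of y] Dn_bounds[OF n, of y] by (auto simp: E_def indicator_def)
      then have "\<psi> y * \<bar>E n y\<bar> \<le> \<psi> y * D y + \<psi> y * Dn n y + \<psi> y * \<bar>A' n y\<bar>"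
        using mult_left_mono[of "\<bar>E n y\<bar>" "D y + Dn n y + \<bar>A' n y\<bar>" "\<psi> y"]
        by (simp add: \<psi>_def distrib_left)
      then have "ennreal (\<psi> y * \<bar>E n y\<bar>) \<le> ennreal (\<psi> y * D y + \<psi> y * Dn n y + \<psi> y * \<bar>A' n y\<bar>)"
        by (rule ennreal_leI)
      then show ?thesis
        using D_bounds[of y] Dn_bounds[OF n, of y] by (simp add: ennreal_plus \<psi>_def)
    qed
    then have "(\<integral>\<^sup>+y\<in>{0..}. ennreal (\<psi> y * \<bar>E n y\<bar>) \<partial>lborel) \<le>
        (\<integral>\<^sup>+y\<in>{0..}. ennreal (\<psi> y * D y) + ennreal (\<psi> y * Dn n y) + ennreal (\<psi> y * \<bar>A' n y\<bar>) \<partial>lborel)"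
      by (intro nn_integral_mono mult_right_mono) auto
    also have "\<dots> = (\<integral>\<^sup>+y\<in>{0..}. ennreal (\<psi> y * D y) \<partial>lborel) +
        (\<integral>\<^sup>+y\<in>{0..}. ennreal (\<psi> y * Dn n y) \<partial>lborel) + (\<integral>\<^sup>+y\<in>{0..}. ennreal (\<psi> y * \<bar>A' n y\<bar>) \<partial>lborel)"
      by (simp add: nn_integral_add distrib_right)
    also have "\<dots> \<le> ennreal K1 + ennreal K2 + ennreal K3"
      using K1(2) K2(2)[OF n] K3(2)[OF n] by (intro add_mono)
    finally show ?thesis
      using K1(1) K2(1) K3(1) by (simp add: ennreal_plus)
  qed

  \<comment> \<open>The uniform size \<open>c * real n powr (- \<kappa>)\<close> of the remainder
    enters as the pointwise bound \<open>c\<close> of the weighted estimate, while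
    \<open>\<epsilon>\<close> is still free.\<close>
  have g_E: "(\<integral>\<^sup>+y\<in>{0..}. ennreal (\<bar>g y\<bar> * \<bar>E n y\<bar>) \<partial>lborel) \<le>
      ennreal (\<epsilon> * (K1 + K2 + K3) + c * real n powr (- \<kappa>) * (C + C * \<epsilon> powr (- 1 / \<theta>)))"
    if n: "1 \<le> n" and \<epsilon>: "0 < \<epsilon>" for n \<epsilon>
  proof -
    note [measurable] = E_meas[OF n]
    have "(\<integral>\<^sup>+y\<in>{0..}. ennreal (\<bar>g y\<bar> * \<bar>E n y\<bar>) \<partial>lborel) \<le>
        ennreal \<epsilon> * (\<integral>\<^sup>+y\<in>{0..}. ennreal (\<psi> y * \<bar>E n y\<bar>) \<partial>lborel) +
        ennreal (c * real n powr (- \<kappa>) * (C + C * \<epsilon> powr (- 1 / \<theta>)))"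
      using \<epsilon> c E_bound[OF n] by (intro bound) auto
    also have "\<dots> \<le> ennreal \<epsilon> * ennreal (K1 + K2 + K3) + ennreal (c * real n powr (- \<kappa>) * (C + C * \<epsilon> powr (- 1 / \<theta>)))"
      using \<psi>_E[OF n] by (intro add_right_mono mult_left_mono) auto
    also have "\<dots> = ennreal (\<epsilon> * (K1 + K2 + K3) + c * real n powr (- \<kappa>) * (C + C * \<epsilon> powr (- 1 / \<theta>)))"
      using \<epsilon> c C K1(1) K2(1) K3(1) by (simp add: ennreal_mult[symmetric] ennreal_plus[symmetric] del: ennreal_plus)
    finally show ?thesis .
  qed

  \<comment> \<open>The same estimate with \<open>\<epsilon> = 1\<close> and pointwise bound 1 gives
    the finiteness that the price formula asks of digital prices.\<close>
  have g_D: "(\<integral>\<^sup>+y\<in>{0..}. ennreal (\<bar>g y\<bar> * e y) \<partial>lborel) < \<infinity>"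
    if "e \<in> borel_measurable borel" "\<And>y. 0 \<le> e y \<and> e y \<le> 1" "(\<integral>\<^sup>+y\<in>{0..}. ennreal (\<psi> y * e y) \<partial>lborel) \<le> ennreal K" for e K
  proof -
    have "(\<integral>\<^sup>+y\<in>{0..}. ennreal (\<bar>g y\<bar> * e y) \<partial>lborel) \<le>
        ennreal 1 * (\<integral>\<^sup>+y\<in>{0..}. ennreal (\<psi> y * e y) \<partial>lborel) + ennreal (1 * (C + C * 1 powr (- 1 / \<theta>)))"
      using that by (intro bound) auto
    also have "\<dots> \<le> ennreal K + ennreal (C + C)"
      using that(3) by (auto intro: add_right_mono)
    also have "\<dots> < \<infinity>"
      by simp
    finally show ?thesis .
  qed
  have fin_D: "(\<integral>\<^sup>+y\<in>{0..}. ennreal (\<bar>g y\<bar> * D y) \<partial>lborel) < \<infinity>"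
    using D_bounds K1(2) by (intro g_D) auto
  have fin_Dn: "(\<integral>\<^sup>+y\<in>{0..}. ennreal (\<bar>g y\<bar> * Dn n y) \<partial>lborel) < \<infinity>" if n: "1 \<le> n" for n
    using Dn_bounds[OF n] Dn_meas[OF n] K2(2)[OF n] by (intro g_D) auto

  have int_D: "set_integrable lborel {0..} (\<lambda>y. g y * D y)"
    using C.integral_layer_cake(1)[OF g_meas] fin_D by (simp add: D_eq)
  have int_Dn: "set_integrable lborel {0..} (\<lambda>y. g y * Dn n y)" if n: "1 \<le> n" for n
    using discounted_claim.integral_layer_cake(1)[OF Cn[OF n] g_meas] fin_Dn[OF n] by (simp add: Dn_eq[OF n])
  have int_E: "set_integrable lborel {0..} (\<lambda>y. g y * E n y)"
    and abs_E: "\<bar>LINT y:{0..}|lborel. g y * E n y\<bar> \<le>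
      \<epsilon> * (K1 + K2 + K3) + c * real n powr (- \<kappa>) * (C + C * \<epsilon> powr (- 1 / \<theta>))"
    if n: "1 \<le> n" and \<epsilon>: "0 < \<epsilon>" for n \<epsilon>
  proof -
    note [measurable] = E_meas[OF n]
    let ?h = "\<lambda>y. indicat_real {0..} y *\<^sub>R (g y * E n y)"
    have eq: "(\<integral>\<^sup>+y. ennreal (norm (?h y)) \<partial>lborel) = (\<integral>\<^sup>+y\<in>{0..}. ennreal (\<bar>g y\<bar> * \<bar>E n y\<bar>) \<partial>lborel)"
      by (intro nn_integral_cong) (auto simp: abs_mult split: split_indicator)
    have int: "integrable lborel ?h"
    proof (rule integrableI_bounded)
      show "(\<integral>\<^sup>+y. ennreal (norm (?h y)) \<partial>lborel) < \<infinity>"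
        unfolding eq using g_E[OF n \<epsilon>] by (rule le_less_trans) simp
    qed measurable
    then show "set_integrable lborel {0..} (\<lambda>y. g y * E n y)"
      by (simp add: set_integrable_def)
    have "ennreal \<bar>LINT y|lborel. ?h y\<bar> \<le> (\<integral>\<^sup>+y. ennreal (norm (?h y)) \<partial>lborel)"
      using integral_norm_bound_ennreal[OF int] by simp
    also have "\<dots> \<le> ennreal (\<epsilon> * (K1 + K2 + K3) + c * real n powr (- \<kappa>) * (C + C * \<epsilon> powr (- 1 / \<theta>)))"
      unfolding eq by (rule g_E[OF n \<epsilon>])
    finally show "\<bar>LINT y:{0..}|lborel. g y * E n y\<bar> \<le>
        \<epsilon> * (K1 + K2 + K3) + c * real n powr (- \<kappa>) * (C + C * \<epsilon> powr (- 1 / \<theta>))"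
      using \<epsilon> c C K1(1) K2(1) K3(1) by (simp add: set_lebesgue_integral_def ennreal_plus[symmetric] del: ennreal_plus)
  qed

  \<comment> \<open>The first-order term and the exact error formula\<close>
  \<comment> \<open>Solving the definition of \<open>E\<close> for \<open>A\<close> expresses the
    first-order integrand through three integrable functions, which proves it integrable as
    well.\<close>
  have A_decomp: "deriv f y * A n y = real n powr \<beta> * (g y * Dn n y - g y * D y - g y * E n y)"
    if "1 \<le> n" "y \<in> {0..}" for n y
    using that by (simp add: E_def A'_def g_def algebra_simps)
  have int_A: "set_integrable lborel {0..} (\<lambda>y. deriv f y * A n y)"
    and lint_A: "(LINT y:{0..}|lborel. deriv f y * A n y) = real n powr \<beta> *
      ((LINT y:{0..}|lborel. g y * Dn n y) - (LINT y:{0..}|lborel. g y * D y) - (LINT y:{0..}|lborel. g y * E n y))"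
    if n: "1 \<le> n" for n
  proof -
    note ints = int_Dn[OF n] int_D int_E[OF n zero_less_one]
    have "set_integrable lborel {0..} (\<lambda>y. real n powr \<beta> * (g y * Dn n y - g y * D y - g y * E n y))"
      using ints by (intro set_integrable_mult_right set_integral_diff) auto
    then show "set_integrable lborel {0..} (\<lambda>y. deriv f y * A n y)"
      by (subst set_integrable_cong[OF refl refl A_decomp[OF n]])
    have "(LINT y:{0..}|lborel. deriv f y * A n y) =
        (LINT y:{0..}|lborel. real n powr \<beta> * (g y * Dn n y - g y * D y - g y * E n y))"
      using A_decomp[OF n] by (intro set_lebesgue_integral_cong) auto
    then show "(LINT y:{0..}|lborel. deriv f y * A n y) = real n powr \<beta> *
      ((LINT y:{0..}|lborel. g y * Dn n y) - (LINT y:{0..}|lborel. g y * D y) - (LINT y:{0..}|lborel. g y * E n y))"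
      using ints by (simp add: set_integral_diff)
  qed

  have price: "payoff_price T M Q X f = f 0 * b + (LINT y:{0..}|lborel. g y * D y)"
    using C.claim_price[OF f assms(11)] fin_D
    by (simp add: g_def payoff_price_def b_def bond_price_def D_eq)
  have price_n: "payoff_price T (Mn n) (Qn n) (Xn n) f = f 0 * bn n + (LINT y:{0..}|lborel. g y * Dn n y)"
    if n: "1 \<le> n" for n
    using discounted_claim.claim_price[OF Cn[OF n] f assms(11)] fin_Dn[OF n]
    by (simp add: g_def payoff_price_def bn_def bond_price_def Dn_eq[OF n])
  let ?err = "\<lambda>n. payoff_price T (Mn n) (Qn n) (Xn n) f -
    (payoff_price T M Q X f + 1 / real n powr \<beta> * (LINT a:{0..}|lborel. deriv f a * A n a))"
  \<comment> \<open>The integrals against \<open>D\<close> and \<open>Dn\<close> cancel, because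
    \<open>lint_A\<close> contains the same difference; what remains is the bond error and the
    remainder integral.\<close>
  have err: "?err n = f 0 * (bn n - b) + (LINT y:{0..}|lborel. g y * E n y)" if n: "1 \<le> n" for n
    using n unfolding price price_n[OF n] lint_A[OF n] by (simp add: algebra_simps)

  \<comment> \<open>Choice of the splitting exponent and the final asymptotics\<close>
  \<comment> \<open>The midpoint of \<open>\<beta>\<close> and
    \<open>\<theta> * (\<kappa> - \<beta>)\<close>, which are in this order by the lower bound on
    \<open>\<theta>\<close>. For \<open>\<epsilon> = real n powr (- s)\<close> the lower end makes
    \<open>\<epsilon>\<close> small enough, and the upper end does so for
    \<open>real n powr (- \<kappa>) * \<epsilon> powr (- 1 / \<theta>)\<close>, of order
    \<open>s / \<theta> - \<kappa>\<close>.\<close>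
  define s where "s = (\<beta> + \<theta> * (\<kappa> - \<beta>)) / 2"
  have s: "\<beta> < s" "s / \<theta> - \<kappa> < - \<beta>"
  proof -
    have "\<beta> < \<theta> * (\<kappa> - \<beta>)"
      using assms(9,15) by (simp add: field_simps)
    then have "\<beta> < s" "s < \<theta> * (\<kappa> - \<beta>)"
      by (auto simp: s_def)
    then show "\<beta> < s" "s / \<theta> - \<kappa> < - \<beta>"
      using \<theta>0 by (auto simp: field_simps)
  qed
  have powr_small: "(\<lambda>n. d * real n powr p) \<in> o(\<lambda>n. real n powr (- \<beta>))" if "p < - \<beta>" for d p
    using that powr_smallo_iff[OF filterlim_real_sequentially, of p "- \<beta>"] by (cases "d = 0") simp_all
  let ?K = "\<lambda>n. (K1 + K2 + K3) * real n powr (- s) + c * C * real n powr (- \<kappa>) + c * C * real n powr (s / \<theta> - \<kappa>)"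
  have "?K \<in> o(\<lambda>n. real n powr (- \<beta>))"
    using s assms(9) by (intro sum_in_smallo powr_small) auto
  moreover have "(\<lambda>n. LINT y:{0..}|lborel. g y * E n y) \<in> O(?K)"
  proof (rule landau_o.big_mono, rule eventually_sequentiallyI[of 1])
    fix n :: nat assume n: "1 \<le> n"
    have "\<bar>LINT y:{0..}|lborel. g y * E n y\<bar> \<le>
        real n powr (- s) * (K1 + K2 + K3) + c * real n powr (- \<kappa>) * (C + C * (real n powr (- s)) powr (- 1 / \<theta>))"
      using n by (intro abs_E) auto
    also have "\<dots> = ?K n"
    proof -
      have "(real n powr (- s)) powr (- 1 / \<theta>) = real n powr (s / \<theta>)"
        by (simp add: powr_powr)
      moreover have "real n powr (s / \<theta> - \<kappa>) = real n powr (- \<kappa>) * real n powr (s / \<theta>)"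
        by (simp add: powr_add[symmetric])
      ultimately show ?thesis
        by (simp add: algebra_simps)
    qed
    finally show "norm (LINT y:{0..}|lborel. g y * E n y) \<le> norm (?K n)"
      by simp
  qed
  ultimately have "(\<lambda>n. LINT y:{0..}|lborel. g y * E n y) \<in> o(\<lambda>n. real n powr (- \<beta>))"
    by (rule landau_o.big_small_trans[rotated])
  moreover have "(\<lambda>n. f 0 * (bn n - b)) \<in> o(\<lambda>n. real n powr (- \<beta>))"
    using assms(12) unfolding bn_def b_def by (cases "f 0 = 0") auto
  ultimately have "(\<lambda>n. f 0 * (bn n - b) + (LINT y:{0..}|lborel. g y * E n y)) \<in> o(\<lambda>n. real n powr (- \<beta>))"
    by (intro sum_in_smallo)
  \<comment> \<open>The error formula is available only from index 1 on, which is enough for an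
    asymptotic statement.\<close>
  moreover have "eventually (\<lambda>n. f 0 * (bn n - b) + (LINT y:{0..}|lborel. g y * E n y) = ?err n) sequentially"
    by (rule eventually_sequentiallyI[of 1]) (rule err[symmetric])
  ultimately have "?err \<in> o(\<lambda>n. real n powr (- \<beta>))"
    by (rule landau_o.small.in_cong[THEN iffD1, rotated])
  then show ?thesis
    using int_A by blast
qed

end
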